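(* Suppose every edge weight function is linear, $f_e(x)=\beta_ex+\alpha_e$ with $\beta_e,\alpha_e\in\mathbb{Z}_{>0}$, and let $\beta=\max_e\beta_e$. Fix $0<\delta<1$ and set $\eta=\frac{\beta}{1-\exp(-\beta)}\big(\ln\frac{n^{\mathtt{h}}}{\delta}+1\big)$. Let $\mathbf{x}'$ be an optimal solution of the linear relaxation $$\min\sum_{e\in E}x_e\quad\text{s.t.}\quad\sum_{e\in p}(\beta_ex_e+\alpha_e)\ge\mathtt{T}\ \ \forall p\in\mathcal{F},\qquad 0\le x_e\le b_e,\ x_e\in\mathbb{R}\ \ \forall e\in E.$$ The Linear Rounding algorithm (LR) outputs $\mathbf{x}$ as follows, independently for each edge $e$: if $x'_e$ is an integer, $x_e=x'_e$; otherwise, with $\rho_e=x'_e-\lfloor x'_e\rfloor$, set $x_e=\lceil x'_e\rceil$ with probability $\min(1,\eta\rho_e)$ and $x_e=\lfloor x'_e\rfloor$ otherwise. Then LR returns a solution within $O(\mathtt{h}\ln n)$ factor of the optimum of the QoSD instance with probability at least $1-\delta$.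
   Context: Let $G=(V,E)$ be a directed graph with $n$ vertices. A box $\mathtt{b}\in\mathbb{Z}_{\ge0}^E$, a set $S$ of vertex pairs $(s_i,t_i)$ and an integer threshold $\mathtt{T}$ are given; $\mathtt{w}=\min_ef_e(0)$ and $\mathtt{h}=\lceil\mathtt{T}/\mathtt{w}\rceil$. Budget vectors are $\mathbf{x}\in\mathbb{Z}_{\ge0}^E$, $\|\mathbf{x}\|=\sum_ex_e$. A single path is a directed path with no repeated vertex; a feasible path is a single path from $s_i$ to $t_i$ for some $(s_i,t_i)\in S$ with $\sum_{e\in p}f_e(0)<\mathtt{T}$; $\mathcal{F}$ is the set of feasible paths. A path is blocked by $\mathbf{x}$ if $\sum_{e\in p}f_e(x_e)\ge\mathtt{T}$. The QoSD problem asks for an integer $\mathbf{0}\le\mathbf{x}\le\mathtt{b}$ of minimum $\|\mathbf{x}\|$ blocking every path in $\mathcal{F}$ (a solution); its optimum is $\mathtt{OPT}$. The $O(\cdot)$ treats $\beta$ and $\delta$ as constants. *)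

theory Defs
  imports "HOL-Probability.Probability" "Graph_Theory.Graph_Theory"
begin

text \<open>
  QoSD instances. A graph \<open>(V,E)\<close> with \<open>E \<subseteq> V \<times> V\<close> is a finite digraph without parallel arcs;
  self-loops are permitted. A directed path without repeated vertices is \<^const>\<open>pre_digraph.apath\<close>,
  represented by its list of arcs (so a path occurs as the empty list iff its endpoints coincide).
\<close>

locale qosd = fin_digraph G + nomulti_digraph G
  for G :: "('v, 'e) pre_digraph" (structure) +
  fixes f :: "'e \<Rightarrow> nat \<Rightarrow> real"
    and b :: "'e \<Rightarrow> nat"
    and S :: "('v \<times> 'v) set"
    and T :: int
  assumes pairs_in_verts: "S \<subseteq> verts G \<times> verts G"
begin

definition feasible_paths :: "'e list set" where
  "feasible_paths = {p. \<exists>(s, t) \<in> S. apath s p t \<and> (\<Sum>e\<leftarrow>p. f e 0) < of_int T}"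

definition blocks :: "('e \<Rightarrow> nat) \<Rightarrow> 'e list \<Rightarrow> bool" where
  "blocks x p \<longleftrightarrow> (\<Sum>e\<leftarrow>p. f e (x e)) \<ge> of_int T"

definition budget :: "('e \<Rightarrow> nat) \<Rightarrow> nat" where
  "budget x = (\<Sum>e\<in>arcs G. x e)"

definition solution :: "('e \<Rightarrow> nat) \<Rightarrow> bool" where
  "solution x \<longleftrightarrow> (\<forall>e\<in>arcs G. x e \<le> b e) \<and> (\<forall>p\<in>feasible_paths. blocks x p)"

definition OPT :: nat where
  "OPT = (INF x \<in> Collect solution. budget x)"

definition w :: real where
  "w = Min ((\<lambda>e. f e 0) ` arcs G)"

definition h :: int where
  "h = \<lceil>of_int T / w\<rceil>"

text \<open>Feasibility for the linear relaxation in the case \<open>f\<^sub>e(x) = \<beta>\<^sub>e x + \<alpha>\<^sub>e\<close>.\<close>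

definition LP_feasible :: "('e \<Rightarrow> nat) \<Rightarrow> ('e \<Rightarrow> nat) \<Rightarrow> ('e \<Rightarrow> real) \<Rightarrow> bool" where
  "LP_feasible \<beta> \<alpha> y \<longleftrightarrow>
     (\<forall>p\<in>feasible_paths. (\<Sum>e\<leftarrow>p. real (\<beta> e) * y e + real (\<alpha> e)) \<ge> of_int T) \<and>
     (\<forall>e\<in>arcs G. 0 \<le> y e \<and> y e \<le> real (b e))"

definition LP_optimal :: "('e \<Rightarrow> nat) \<Rightarrow> ('e \<Rightarrow> nat) \<Rightarrow> ('e \<Rightarrow> real) \<Rightarrow> bool" where
  "LP_optimal \<beta> \<alpha> y \<longleftrightarrow> is_arg_min (\<lambda>y. \<Sum>e\<in>arcs G. y e) (LP_feasible \<beta> \<alpha>) y"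

end

definition LR_eta :: "nat \<Rightarrow> nat \<Rightarrow> int \<Rightarrow> real \<Rightarrow> real" where
  "LR_eta \<beta> n h \<delta> =
     real \<beta> / (1 - exp (- real \<beta>)) * (ln (real n powi h / \<delta>) + 1)"

definition LR_edge :: "real \<Rightarrow> real \<Rightarrow> nat pmf" where
  "LR_edge \<eta> r =
     (if r \<in> \<int> then return_pmf (nat \<lfloor>r\<rfloor>)
      else map_pmf (\<lambda>up. if up then nat \<lceil>r\<rceil> else nat \<lfloor>r\<rfloor>)
             (bernoulli_pmf (min 1 (\<eta> * frac r))))"

text \<open>The distribution of the output of LR: independent rounding of all arcs (0 outside the graph).\<close>

definition LR :: "('v, 'e) pre_digraph \<Rightarrow> real \<Rightarrow> ('e \<Rightarrow> real) \<Rightarrow> ('e \<Rightarrow> nat) pmf" where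
  "LR G \<eta> x' = Pi_pmf (arcs G) 0 (\<lambda>e. LR_edge \<eta> (x' e))"

end

theory Submission
  imports Defs
begin

text \<open>
  A feasible path has fewer than \<open>h\<close> arcs, so there are at most \<open>n ^ h\<close> of them. For a fixed path, let
  \<open>m\<^sub>e\<close> be the smallest possible rounded value of arc \<open>e\<close>, and let \<open>D\<close> be what \<open>m\<close> still lacks to
  block the path. If \<open>D \<ge> 1\<close>, then failing to block means \<open>\<Sum> \<beta>\<^sub>e (x\<^sub>e - m\<^sub>e) \<le> D - 1\<close> by integrality,
  and the exponential moment of parameter 1 bounds this probability by \<open>exp (D - 1 - D L)\<close> with
  \<open>L = ln (n ^ h / \<delta>) + 1\<close>, hence by \<open>exp (- L) = \<delta> / (e n ^ h)\<close>. A union bound gives total failure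
  probability \<open>\<delta> / e\<close>. The expected budget is at most \<open>\<eta>\<close> times the LP value, and the remaining
  \<open>\<delta> (1 - 1 / e)\<close> is spent on Markov's inequality for the budget.
\<close>

section \<open>Rounding a single arc\<close>

text \<open>An arc whose rounding probability is capped at 1 is rounded up with certainty, so its base is the
  ceiling; this keeps the Chernoff estimate valid, which needs the uncapped probability.\<close>

definition LR_base :: "real \<Rightarrow> real \<Rightarrow> nat" where
  "LR_base \<eta> r = (if r \<in> \<int> \<or> 1 \<le> \<eta> * frac r then nat \<lceil>r\<rceil> else nat \<lfloor>r\<rfloor>)"

text \<open>The amount of \<open>r\<close> above the base that is left to chance. It is 0 on arcs
  rounded with certainty, so such arcs contribute a factor 1 to the exponential moment.\<close>

definition LR_gap :: "real \<Rightarrow> real \<Rightarrow> real" where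
  "LR_gap \<eta> r = (if r \<in> \<int> \<or> 1 \<le> \<eta> * frac r then 0 else frac r)"

text \<open>Turns a lower bound on the fractional values along a path into a lower bound on the
  total gap; a capped arc only helps, its base being the ceiling.\<close>

lemma le_LR_base_plus_gap: "r \<le> real (LR_base \<eta> r) + LR_gap \<eta> r"
proof -
  have "r = of_int \<lfloor>r\<rfloor> + frac r" by (simp add: frac_def)
  then show ?thesis
    unfolding LR_base_def LR_gap_def by (auto intro: order_trans[OF le_of_int_ceiling]) linarith+
qed

lemma finite_set_LR_edge [simp]: "finite (set_pmf (LR_edge \<eta> r))"
  by (simp add: LR_edge_def)

lemma set_LR_edge_le: "y \<in> set_pmf (LR_edge \<eta> r) \<Longrightarrow> y \<le> nat \<lceil>r\<rceil>"
  by (auto simp: LR_edge_def split: if_splits intro!: nat_mono floor_le_ceiling)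

lemma LR_edge_sure:
  assumes "1 \<le> \<eta> * frac r"
  shows "LR_edge \<eta> r = return_pmf (nat \<lceil>r\<rceil>)"
proof -
  have "bernoulli_pmf 1 = return_pmf True"
    by (rule pmf_eqI) (auto simp: indicator_def elim: bool.exhaust split: split_indicator)
  then show ?thesis
    using assms by (auto simp: LR_edge_def min_def elim!: Ints_cases)
qed

lemma LR_base_le_set_LR_edge:
  assumes "y \<in> set_pmf (LR_edge \<eta> r)"
  shows "LR_base \<eta> r \<le> y"
proof (cases "1 \<le> \<eta> * frac r")
  case True
  then show ?thesis using assms by (simp add: LR_edge_sure LR_base_def)
next
  case False
  then show ?thesis using assms
    by (auto simp: LR_base_def LR_edge_def elim!: Ints_cases split: if_splits intro!: nat_mono floor_le_ceiling)
qed

text \<open>Convexity of the exponential, on the chord over \<open>[-B, 0]\<close>.\<close>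

lemma chord_bound_exp:
  fixes b B :: real
  assumes "0 < b" "b \<le> B"
  shows "b * (1 - exp (- B)) / B \<le> 1 - exp (- b)"
proof -
  have "exp ((1 - b / B) *\<^sub>R 0 + (b / B) *\<^sub>R (- B)) \<le> (1 - b / B) * exp 0 + (b / B) * exp (- B)"
    using assms by (intro convex_onD[OF exp_convex]) (auto simp: field_simps)
  then show ?thesis using assms by (simp add: algebra_simps diff_divide_distrib)
qed

text \<open>Deterministic rounding gives 1 on both sides. Otherwise, with q =
  \<open>\<eta> * frac r\<close>, the moment is 1 - q (1 - exp (-\<beta>)), at most exp (-q (1 - exp
  (-\<beta>))). The chord bound makes this exponent linear in \<beta>, and the factor B / (1 - exp
  (-B)) of \<eta> cancels its slope.\<close>

lemma expectation_exp_LR_edge: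
  fixes \<beta> B L :: real
  assumes "0 \<le> r" "0 < \<beta>" "\<beta> \<le> B" "0 \<le> L" and \<eta>: "\<eta> = B / (1 - exp (- B)) * L"
  shows "measure_pmf.expectation (LR_edge \<eta> r) (\<lambda>y. exp (- \<beta> * (real y - real (LR_base \<eta> r))))
    \<le> exp (- (\<beta> * LR_gap \<eta> r * L))"
proof -
  have "1 - exp (-B) > 0" using assms by simp
  then have "0 \<le> \<eta>" using assms by simp
  consider "r \<in> \<int>" | "1 \<le> \<eta> * frac r" | "r \<notin> \<int>" "\<eta> * frac r < 1" by linarith
  then show ?thesis
  proof cases
    case 1
    then show ?thesis by (auto simp: LR_edge_def LR_base_def LR_gap_def elim!: Ints_cases)
  next
    case 2
    then show ?thesis by (simp add: LR_edge_sure LR_base_def LR_gap_def)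
  next
    case 3
    have up: "real (nat \<lceil>r\<rceil>) - real (nat \<lfloor>r\<rfloor>) = 1"
      using 3 assms(1) by (simp add: ceiling_altdef) (metis Ints_of_int)
    have "measure_pmf.expectation (LR_edge \<eta> r) (\<lambda>y. exp (- \<beta> * (real y - real (LR_base \<eta> r))))
      = 1 - \<eta> * frac r * (1 - exp (- \<beta>))"
      using 3 \<open>0 \<le> \<eta>\<close> up by (simp add: LR_edge_def LR_base_def min_def algebra_simps)
    also have "\<dots> \<le> exp (- (\<eta> * frac r * (1 - exp (- \<beta>))))"
      using exp_ge_add_one_self[of "- (\<eta> * frac r * (1 - exp (- \<beta>)))"] by simp
    also have "\<dots> \<le> exp (- (\<eta> * frac r * (\<beta> * (1 - exp (- B)) / B)))"
      using chord_bound_exp[OF assms(2,3)] \<open>0 \<le> \<eta>\<close> by (simp add: mult_left_mono del: times_divide_eq_right)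
    also have "\<eta> * frac r * (\<beta> * (1 - exp (- B)) / B) = \<beta> * LR_gap \<eta> r * L"
    proof -
      have "LR_gap \<eta> r = frac r" using 3 by (simp add: LR_gap_def)
      then show ?thesis
      using \<open>1 - exp (-B) > 0\<close> assms(2,3) by (simp add: \<eta> field_simps)
    qed
    finally show ?thesis .
  qed
qed

text \<open>The mean is the floor plus the rounding probability; \<open>1 \<le> \<eta>\<close>
  allows the floor to be scaled by \<eta> as well.\<close>

lemma expectation_LR_edge:
  assumes "0 \<le> r" "1 \<le> \<eta>"
  shows "measure_pmf.expectation (LR_edge \<eta> r) real \<le> \<eta> * r"
proof (cases "r \<in> \<int>")
  case True
  then show ?thesis using assms mult_right_mono[of 1 \<eta> r]
    by (auto simp: LR_edge_def elim!: Ints_cases)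
next
  case False
  have up: "real (nat \<lceil>r\<rceil>) = real (nat \<lfloor>r\<rfloor>) + 1"
    using False assms(1) by (simp add: ceiling_altdef) (metis Ints_of_int)
  have r: "r = real (nat \<lfloor>r\<rfloor>) + frac r" using assms by (simp add: frac_def)
  have "measure_pmf.expectation (LR_edge \<eta> r) real = real (nat \<lfloor>r\<rfloor>) + min 1 (\<eta> * frac r)"
    using False assms by (simp add: LR_edge_def up algebra_simps)
  also have "\<dots> \<le> \<eta> * real (nat \<lfloor>r\<rfloor>) + \<eta> * frac r"
    using assms mult_right_mono[of 1 \<eta> "real (nat \<lfloor>r\<rfloor>)"] by (intro add_mono) auto
  also have "\<dots> = \<eta> * r" by (subst (3) r) (simp add: algebra_simps)
  finally show ?thesis .
qed

section \<open>Lower tail of the rounded weight of one path\<close>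

lemma finite_set_Pi_LR_edge:
  "finite A \<Longrightarrow> finite (set_pmf (Pi_pmf A 0 (\<lambda>e. LR_edge \<eta> (x' e))))"
  by (auto simp: set_Pi_pmf)

lemma prob_rounded_sum_less:
  fixes \<beta> :: "'e \<Rightarrow> nat" and x' :: "'e \<Rightarrow> real" and D :: int and L :: real and B :: nat
  assumes "finite A" "P \<subseteq> A" and \<beta>: "\<And>e. e \<in> P \<Longrightarrow> 0 < \<beta> e \<and> \<beta> e \<le> B"
    and x': "\<And>e. e \<in> P \<Longrightarrow> 0 \<le> x' e" and "1 \<le> L" and \<eta>: "\<eta> = real B / (1 - exp (- real B)) * L"
    and D: "of_int D \<le> (\<Sum>e\<in>P. real (\<beta> e) * x' e)"
  shows "measure_pmf.prob (Pi_pmf A 0 (\<lambda>e. LR_edge \<eta> (x' e)))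
    {x. (\<Sum>e\<in>P. real (\<beta> e) * real (x e)) < of_int D} \<le> exp (- L)"
proof -
  define M where "M = Pi_pmf A 0 (\<lambda>e. LR_edge \<eta> (x' e))"
  define m where "m e = LR_base \<eta> (x' e)" for e
  define D' where "D' = D - (\<Sum>e\<in>P. int (\<beta> e) * int (m e))"
  have finM: "finite (set_pmf M)" unfolding M_def using assms(1) by (rule finite_set_Pi_LR_edge)
  let ?F = "{x. (\<Sum>e\<in>P. real (\<beta> e) * real (x e)) < of_int D}"
  have rD': "of_int D' = of_int D - (\<Sum>e\<in>P. real (\<beta> e) * real (m e))"
    by (simp add: D'_def)
  have "measure_pmf.prob M ?F \<le> exp (- L)"
  proof (cases "D' \<le> 0")
    case True
    \<comment> \<open>The base values alone already reach \<open>D\<close>, and no outcome lies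
      below the base.\<close>
    have "x \<notin> ?F" if "x \<in> set_pmf M" for x
    proof -
      have "m e \<le> x e" if "e \<in> P" for e
        using that \<open>x \<in> set_pmf M\<close> assms(1,2) unfolding M_def m_def
        by (auto simp: set_Pi_pmf PiE_dflt_def intro!: LR_base_le_set_LR_edge)
      then have "(\<Sum>e\<in>P. real (\<beta> e) * real (m e)) \<le> (\<Sum>e\<in>P. real (\<beta> e) * real (x e))"
        by (intro sum_mono mult_left_mono) auto
      moreover have "real_of_int D' \<le> 0" using True by simp
      ultimately show ?thesis using rD' by simp
    qed
    then have "measure_pmf.prob M ?F = 0" by (subst measure_pmf_zero_iff) auto
    then show ?thesis by simp
  next
    case False
    \<comment> \<open>The factor 1 outside \<open>P\<close> extends the product to all of
      \<open>A\<close>, the index set of the product measure, so that independence applies.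
      \<open>c\<close> is the value of the product at total excess \<open>D' - 1\<close>.\<close>
    define g where "g e y = (if e \<in> P then exp (- real (\<beta> e) * (real y - real (m e))) else 1)" for e and y :: nat
    define c where "c = exp (- (of_int D' - 1 :: real))"
    have prod_g: "(\<Prod>e\<in>A. g e (x e)) = exp (- (\<Sum>e\<in>P. real (\<beta> e) * (real (x e) - real (m e))))" for x
    proof -
      have "(\<Prod>e\<in>A. g e (x e)) = (\<Prod>e\<in>P. exp (- real (\<beta> e) * (real (x e) - real (m e))))"
        unfolding g_def using assms(1,2) by (subst prod.inter_restrict[symmetric]) (auto simp: Int_absorb1)
      then show ?thesis using finite_subset[OF assms(2,1)] by (simp add: exp_sum sum_negf[symmetric])
    qed
    \<comment> \<open>By integrality, failure means falling short of \<open>D'\<close> by at least 1; this spare unit in the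
      exponent absorbs the summand 1 of \<open>L\<close>.\<close>
    have "?F \<subseteq> {x. c \<le> (\<Prod>e\<in>A. g e (x e))}"
    proof safe
      fix x assume "(\<Sum>e\<in>P. real (\<beta> e) * real (x e)) < of_int D"
      then have "of_int (\<Sum>e\<in>P. int (\<beta> e) * int (x e)) < (of_int D :: real)" by simp
      then have "(\<Sum>e\<in>P. int (\<beta> e) * int (x e)) \<le> D - 1" by linarith
      then have "of_int (\<Sum>e\<in>P. int (\<beta> e) * int (x e)) \<le> (of_int (D - 1) :: real)" by linarith
      then show "c \<le> (\<Prod>e\<in>A. g e (x e))"
        unfolding prod_g c_def by (simp add: rD' right_diff_distrib sum_subtractf)
    qed
    then have "measure_pmf.prob M ?F \<le> measure_pmf.prob M {x. c \<le> (\<Prod>e\<in>A. g e (x e))}"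
      by (intro measure_pmf.finite_measure_mono) auto
    also have "\<dots> \<le> measure_pmf.expectation M (\<lambda>x. \<Prod>e\<in>A. g e (x e)) / c"
      using integral_Markov_inequality_measure[of M "\<lambda>x. \<Prod>e\<in>A. g e (x e)" "{}" c] 
      by (simp add: integrable_measure_pmf_finite[OF finM] prod_g c_def)
    also have "measure_pmf.expectation M (\<lambda>x. \<Prod>e\<in>A. g e (x e))
      = (\<Prod>e\<in>A. measure_pmf.expectation (LR_edge \<eta> (x' e)) (g e))"
      unfolding M_def using assms(1)
      by (intro expectation_prod_Pi_pmf) (auto intro!: integrable_measure_pmf_finite simp: g_def)
    also have "\<dots> = (\<Prod>e\<in>P. measure_pmf.expectation (LR_edge \<eta> (x' e)) (g e))"
      using assms(1,2) by (intro prod.mono_neutral_right) (auto simp: g_def[abs_def])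
    also have "\<dots> \<le> (\<Prod>e\<in>P. exp (- (real (\<beta> e) * LR_gap \<eta> (x' e) * L)))"
    proof (rule prod_mono)
      fix e assume "e \<in> P"
      then have "measure_pmf.expectation (LR_edge \<eta> (x' e)) (g e)
          \<le> exp (- (real (\<beta> e) * LR_gap \<eta> (x' e) * L))"
        using expectation_exp_LR_edge[of "x' e" "real (\<beta> e)" "real B" L \<eta>] \<beta>[of e] x'[of e] \<eta> \<open>1 \<le> L\<close>
        by (simp add: g_def[abs_def] m_def del: times_divide_eq_left)
      moreover have "0 \<le> measure_pmf.expectation (LR_edge \<eta> (x' e)) (g e)"
        by (intro Bochner_Integration.integral_nonneg) (auto simp: g_def)
      ultimately show "0 \<le> measure_pmf.expectation (LR_edge \<eta> (x' e)) (g e) \<and>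
        measure_pmf.expectation (LR_edge \<eta> (x' e)) (g e) \<le> exp (- (real (\<beta> e) * LR_gap \<eta> (x' e) * L))"
        by simp
    qed
    also have "\<dots> = exp (- ((\<Sum>e\<in>P. real (\<beta> e) * LR_gap \<eta> (x' e)) * L))"
      using finite_subset[OF assms(2,1)] by (simp add: exp_sum[symmetric] sum_negf sum_distrib_right)
    also have "\<dots> \<le> exp (- (of_int D' * L))"
    proof -
      have "(\<Sum>e\<in>P. real (\<beta> e) * x' e) \<le> (\<Sum>e\<in>P. real (\<beta> e) * (real (m e) + LR_gap \<eta> (x' e)))"
        unfolding m_def by (intro sum_mono mult_left_mono le_LR_base_plus_gap) auto
      with D have "of_int D' \<le> (\<Sum>e\<in>P. real (\<beta> e) * LR_gap \<eta> (x' e))"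
        unfolding rD' by (simp add: distrib_left sum.distrib)
      then show ?thesis using \<open>1 \<le> L\<close> by (simp add: mult_right_mono)
    qed
    \<comment> \<open>Isolates a product that is nonnegative since \<open>D' \<ge> 1\<close> and
      \<open>L \<ge> 1\<close>; dropping it leaves a bound that does not depend on the
      deficit.\<close>
    also have "exp (- (of_int D' * L)) / c = exp (- L - (of_int D' - 1) * (L - 1))"
      unfolding c_def exp_diff[symmetric] by (simp add: algebra_simps)
    also have "\<dots> \<le> exp (- L)"
    proof -
      have "1 \<le> real_of_int D'" using False by simp
      then show ?thesis using \<open>1 \<le> L\<close> by simp
    qed
    finally show ?thesis by (simp add: c_def divide_right_mono)
  qed
  then show ?thesis by (simp add: M_def)
qed

section \<open>Counting feasible paths\<close>

text \<open>Shows that padding can be undone: \<open>remdups\<close> keeps last occurrences, so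
  copies of the final element at the end do not change the order.\<close>

lemma remdups_append_replicate_last:
  "distinct xs \<Longrightarrow> xs \<noteq> [] \<Longrightarrow> remdups (xs @ replicate k (last xs)) = xs"
proof (induction xs)
  case (Cons a xs)
  then show ?case
  proof (cases xs)
    case Nil
    then show ?thesis by (induction k) auto
  qed auto
qed simp

context nomulti_digraph
begin

text \<open>Without parallel arcs, consecutive vertices determine the arc between them. The head of
  the first arc is the first vertex of the remaining list, so the induction peels off one arc at a
  time.\<close>

lemma awalk_verts_inject:
  assumes "cas u p v" "set p \<subseteq> arcs G" "cas u' q v'" "set q \<subseteq> arcs G"
    and "awalk_verts u p = awalk_verts u' q"
  shows "p = q"
  using assms
proof (induction p arbitrary: u u' q)
  case Nil
  then show ?case by (cases q) (auto dest: sym[of "[]"])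
next
  case (Cons a p)
  then obtain c q' where q: "q = c # q'" by (cases q) auto
  have eq: "awalk_verts (head G a) p = awalk_verts (head G c) q'" "tail G a = tail G c"
    using Cons.prems q by auto
  moreover have "head G a = head G c"
    using awhd_if_cas[of "head G a" p v] awhd_if_cas[of "head G c" q' v'] Cons.prems q eq(1) by simp
  ultimately have "a = c"
    using Cons.prems q by (intro no_multi_arcs) (auto simp: arc_to_ends_def)
  moreover have "p = q'"
    using Cons.IH[OF _ _ _ _ eq(1)] Cons.prems q by simp
  ultimately show ?case using q by simp
qed

end

context qosd
begin

lemma feasible_pathE:
  assumes "p \<in> feasible_paths"
  obtains s t where "(s, t) \<in> S" "apath s p t" "(\<Sum>e\<leftarrow>p. f e 0) < of_int T"
  using assms by (auto simp: feasible_paths_def)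

lemma feasible_path_arcs:
  assumes "p \<in> feasible_paths"
  shows "set p \<subseteq> arcs G" "distinct p"
proof -
  obtain s t where "awalk s p t" "distinct (awalk_verts s p)"
    using assms unfolding apath_def by (elim feasible_pathE) (auto simp: apath_def)
  then show "set p \<subseteq> arcs G" "distinct p"
    by (auto simp: awalk_def intro: distinct_verts_imp_distinct)
qed

lemma sum_list_feasible_path:
  assumes "p \<in> feasible_paths"
  shows "(\<Sum>e\<leftarrow>p. g e :: 'a :: comm_monoid_add) = (\<Sum>e\<in>set p. g e)"
  using feasible_path_arcs[OF assms] by (simp add: sum_list_distinct_conv_sum_set)

text \<open>Each arc costs at least \<open>w\<close> at zero budget while the total is below
  \<open>T\<close>. The inequality is strict, so the path has at most \<open>h\<close> vertices, one
  more than its arcs. Nonemptiness makes the minimum \<open>w\<close> range over a nonempty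
  set.\<close>

lemma length_feasible_path:
  assumes p: "p \<in> feasible_paths" and pos: "\<And>e. e \<in> arcs G \<Longrightarrow> 0 < f e 0" and "p \<noteq> []"
  shows "int (length p) < h"
proof -
  have sub: "set p \<subseteq> arcs G" using feasible_path_arcs[OF p] by simp
  then have ne: "arcs G \<noteq> {}" using \<open>p \<noteq> []\<close> by auto
  have "0 < w" unfolding w_def using ne pos by (subst Min_gr_iff) auto
  have "w * real (length p) = (\<Sum>e\<leftarrow>p. w)" by (simp add: sum_list_triv)
  also have "\<dots> \<le> (\<Sum>e\<leftarrow>p. f e 0)"
    using sub by (intro sum_list_mono) (auto simp: w_def)
  also have "\<dots> < of_int T" using p by (auto elim: feasible_pathE)
  finally have "real (length p) < of_int T / w" using \<open>0 < w\<close> by (simp add: field_simps)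
  then show ?thesis unfolding h_def by linarith
qed

text \<open>Padding the vertex list of a path to length \<^term>\<open>h\<close> by repeating its last vertex loses no
  information, because the vertices of a path are distinct.\<close>

lemma card_feasible_paths:
  assumes pos: "\<And>e. e \<in> arcs G \<Longrightarrow> 0 < f e 0" and ne: "[] \<notin> feasible_paths"
  shows "finite feasible_paths" "card feasible_paths \<le> card (verts G) ^ nat h"
proof -
  \<comment> \<open>The start vertex is read off the first arc, which makes the vertex list a
    function of \<open>p\<close> alone; this relies on the absence of empty feasible paths.\<close>
  define vs where "vs p = awalk_verts (tail G (hd p)) p" for p
  define pad where "pad p = vs p @ replicate (nat h - length (vs p)) (last (vs p))" for p
  have vs: "distinct (vs p)" "vs p \<noteq> []" "set (vs p) \<subseteq> verts G" "length (vs p) \<le> nat h"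
      "cas (tail G (hd p)) p (last (vs p))"
    if p: "p \<in> feasible_paths" for p
  proof -
    obtain s t where st: "apath s p t" using p by (elim feasible_pathE)
    have "p \<noteq> []" using p ne by auto
    then have s: "tail G (hd p) = s" using st by (cases p) (auto simp: apath_def awalk_def)
    show "distinct (vs p)" "vs p \<noteq> []" using st by (auto simp: vs_def s apath_def)
    show "set (vs p) \<subseteq> verts G" using st by (auto simp: vs_def s apath_def awalk_verts_in_verts awalk_def)
    show "length (vs p) \<le> nat h"
      using length_feasible_path[OF p pos \<open>p \<noteq> []\<close>] by (simp add: vs_def length_awalk_verts)
    show "cas (tail G (hd p)) p (last (vs p))"
      using st by (auto simp: vs_def s apath_def awalk_def awlast_if_cas)
  qed
  have "inj_on pad feasible_paths"
  proof (rule inj_onI)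
    fix p q assume pq: "p \<in> feasible_paths" "q \<in> feasible_paths" "pad p = pad q"
    then have "vs p = vs q"
      by (metis pad_def remdups_append_replicate_last vs(1,2))
    then show "p = q"
      using awalk_verts_inject[OF vs(5)[OF pq(1)] _ vs(5)[OF pq(2)]] feasible_path_arcs pq(1,2)
      by (simp add: vs_def)
  qed
  moreover have "pad ` feasible_paths \<subseteq> {xs. set xs \<subseteq> verts G \<and> length xs = nat h}" (is "_ \<subseteq> ?L")
  proof safe
    fix p x assume p: "p \<in> feasible_paths"
    show "length (pad p) = nat h" using vs(4)[OF p] by (simp add: pad_def)
    assume "x \<in> set (pad p)"
    then have "x \<in> set (vs p)" using vs(2)[OF p] by (auto simp: pad_def split: if_splits)
    then show "x \<in> verts G" using vs(3)[OF p] by auto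
  qed
  moreover have "finite ?L" by (rule finite_lists_length_eq) simp
  ultimately show "finite feasible_paths" "card feasible_paths \<le> card (verts G) ^ nat h"
    using card_inj_on_le[of pad feasible_paths ?L]
    by (auto simp: card_lists_length_eq intro: inj_on_finite)
qed

end

section \<open>Linear weights and the relaxation\<close>

locale linear_qosd = qosd +
  fixes \<beta> \<alpha> :: "'b \<Rightarrow> nat"
  assumes weights_pos: "e \<in> arcs G \<Longrightarrow> 0 < \<beta> e" "e \<in> arcs G \<Longrightarrow> 0 < \<alpha> e"
    and linear_f: "e \<in> arcs G \<Longrightarrow> f e k = real (\<beta> e * k + \<alpha> e)"
begin

text \<open>Moving the constants \<alpha> to the threshold keeps it an integer, the form that the
  tail bound expects.\<close>

lemma blocks_iff:
  assumes "p \<in> feasible_paths"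
  shows "blocks x p \<longleftrightarrow> of_int (T - (\<Sum>e\<in>set p. int (\<alpha> e))) \<le> (\<Sum>e\<in>set p. real (\<beta> e) * real (x e))"
proof -
  have "(\<Sum>e\<leftarrow>p. f e (x e)) = (\<Sum>e\<in>set p. real (\<beta> e) * real (x e) + real (\<alpha> e))"
    unfolding sum_list_feasible_path[OF assms]
    using feasible_path_arcs[OF assms] by (intro sum.cong) (auto simp: linear_f)
  then show ?thesis by (auto simp: blocks_def sum.distrib)
qed

lemma LP_feasible_of_solution: "solution x \<Longrightarrow> LP_feasible \<beta> \<alpha> (\<lambda>e. real (x e))"
  unfolding solution_def LP_feasible_def
  by (auto simp: blocks_iff sum_list_feasible_path sum.distrib)

lemma LP_feasible_path:
  assumes "LP_feasible \<beta> \<alpha> y" "p \<in> feasible_paths"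
  shows "of_int (T - (\<Sum>e\<in>set p. int (\<alpha> e))) \<le> (\<Sum>e\<in>set p. real (\<beta> e) * y e)"
  using assms unfolding LP_feasible_def by (auto simp: sum_list_feasible_path sum.distrib)

lemma LP_feasible_ge_0: "LP_feasible \<beta> \<alpha> y \<Longrightarrow> e \<in> arcs G \<Longrightarrow> 0 \<le> y e"
  by (simp add: LP_feasible_def)

text \<open>Since \<open>y \<le> b\<close> and the weights increase with the budget, the full box
  blocks whatever \<open>y\<close> blocks. Hence solutions exist and the infimum defining
  \<open>OPT\<close> is attained.\<close>

lemma solution_b:
  assumes "LP_feasible \<beta> \<alpha> y"
  shows "solution b"
  unfolding solution_def
proof safe
  fix p assume p: "p \<in> feasible_paths"
  have "(\<Sum>e\<in>set p. real (\<beta> e) * y e) \<le> (\<Sum>e\<in>set p. real (\<beta> e) * real (b e))"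
    using assms feasible_path_arcs(1)[OF p]
    by (intro sum_mono mult_left_mono) (auto simp: LP_feasible_def)
  then show "blocks b p"
    using LP_feasible_path[OF assms p] by (simp add: blocks_iff[OF p])
qed

lemma LP_value_le_OPT:
  assumes "LP_optimal \<beta> \<alpha> y"
  shows "(\<Sum>e\<in>arcs G. y e) \<le> real OPT"
proof -
  have "LP_feasible \<beta> \<alpha> y" using assms by (simp add: LP_optimal_def is_arg_min_def)
  then have "budget ` Collect solution \<noteq> {}" using solution_b by auto
  then obtain x where x: "solution x" "OPT = budget x"
    using Inf_nat_def1[of "budget ` Collect solution"] by (auto simp: OPT_def)
  then have "(\<Sum>e\<in>arcs G. y e) \<le> (\<Sum>e\<in>arcs G. real (x e))"
    using LP_feasible_of_solution assms by (auto simp: LP_optimal_def is_arg_min_linorder)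
  then show ?thesis by (simp add: x budget_def)
qed

text \<open>An empty path has weight 0 under every budget: feasibility says \<open>0 < T\<close>,
  the LP constraint says \<open>T \<le> 0\<close>.\<close>

lemma Nil_not_feasible:
  assumes "LP_feasible \<beta> \<alpha> y"
  shows "[] \<notin> feasible_paths"
proof
  assume p: "[] \<in> feasible_paths"
  then have "0 < T" by (elim feasible_pathE) simp
  then show False using assms p by (auto simp: LP_feasible_def)
qed

section \<open>Expected budget and failure probability of LR\<close>

lemma set_LR_le_b:
  assumes "LP_feasible \<beta> \<alpha> y" "x \<in> set_pmf (LR G \<eta> y)" "e \<in> arcs G"
  shows "x e \<le> b e"
proof -
  have "x e \<in> set_pmf (LR_edge \<eta> (y e))"
    using assms(2,3) by (auto simp: LR_def set_Pi_pmf PiE_dflt_def)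
  then have "x e \<le> nat \<lceil>y e\<rceil>" by (rule set_LR_edge_le)
  also have "\<dots> \<le> b e" using assms(1,3) by (simp add: LP_feasible_def ceiling_le_iff)
  finally show ?thesis .
qed

lemma expectation_budget_LR:
  assumes "LP_feasible \<beta> \<alpha> y" "1 \<le> \<eta>"
  shows "measure_pmf.expectation (LR G \<eta> y) (\<lambda>x. real (budget x)) \<le> \<eta> * (\<Sum>e\<in>arcs G. y e)"
proof -
  have fin: "finite (set_pmf (LR G \<eta> y))"
    unfolding LR_def by (rule finite_set_Pi_LR_edge) simp
  have "measure_pmf.expectation (LR G \<eta> y) (\<lambda>x. real (budget x))
      = (\<Sum>e\<in>arcs G. measure_pmf.expectation (LR G \<eta> y) (\<lambda>x. real (x e)))"
    unfolding budget_def of_nat_sum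
    by (intro Bochner_Integration.integral_sum integrable_measure_pmf_finite fin)
  also have "\<dots> \<le> (\<Sum>e\<in>arcs G. \<eta> * y e)"
  proof (rule sum_mono)
    fix e assume e: "e \<in> arcs G"
    have "measure_pmf.expectation (LR G \<eta> y) (\<lambda>x. real (x e))
        = measure_pmf.expectation (map_pmf (\<lambda>x. x e) (LR G \<eta> y)) real" by simp
    also have "\<dots> = measure_pmf.expectation (LR_edge \<eta> (y e)) real"
      using e by (simp add: LR_def Pi_pmf_component)
    also have "\<dots> \<le> \<eta> * y e"
      using assms e by (intro expectation_LR_edge) (auto simp: LP_feasible_ge_0)
    finally show "measure_pmf.expectation (LR G \<eta> y) (\<lambda>x. real (x e)) \<le> \<eta> * y e" .
  qed
  finally show ?thesis by (simp add: sum_distrib_left)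
qed

text \<open>The box constraints hold surely, so failure means that some feasible path is unblocked;
  the union bound sums the tail estimate over all of them.\<close>

lemma prob_not_solution_LR:
  assumes y: "LP_feasible \<beta> \<alpha> y" and "1 \<le> L"
    and \<eta>: "\<eta> = real B / (1 - exp (- real B)) * L" and B: "\<And>e. e \<in> arcs G \<Longrightarrow> \<beta> e \<le> B"
  shows "measure_pmf.prob (LR G \<eta> y) {x. \<not> solution x} \<le> real (card (verts G)) ^ nat h * exp (- L)"
proof -
  let ?M = "LR G \<eta> y"
  have pos: "0 < f e 0" if "e \<in> arcs G" for e
    using that weights_pos by (simp add: linear_f)
  note paths = card_feasible_paths[OF pos Nil_not_feasible[OF y]]
  have "measure_pmf.prob ?M {x. \<not> solution x} \<le> measure_pmf.prob ?M (\<Union>p\<in>feasible_paths. {x. \<not> blocks x p})"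
    using set_LR_le_b[OF y] by (intro measure_pmf.finite_measure_mono_AE) (auto simp: AE_measure_pmf_iff solution_def)
  also have "\<dots> \<le> (\<Sum>p\<in>feasible_paths. measure_pmf.prob ?M {x. \<not> blocks x p})"
    using paths(1) by (intro measure_pmf.finite_measure_subadditive_finite) auto
  also have "\<dots> \<le> (\<Sum>p\<in>feasible_paths. exp (- L))"
  proof (rule sum_mono)
    fix p assume p: "p \<in> feasible_paths"
    note sub = feasible_path_arcs(1)[OF p]
    show "measure_pmf.prob ?M {x. \<not> blocks x p} \<le> exp (- L)"
      unfolding blocks_iff[OF p] LR_def not_le
      using sub weights_pos B \<open>1 \<le> L\<close> LP_feasible_ge_0[OF y] LP_feasible_path[OF y p]
      by (intro prob_rounded_sum_less[where B = B]) (auto simp: \<eta>)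
  qed
  also have "\<dots> \<le> real (card (verts G)) ^ nat h * exp (- L)"
    using paths(2) by (simp del: of_nat_power add: of_nat_power[symmetric])
  finally show ?thesis .
qed

section \<open>Degenerate instances and combination of the two failure bounds\<close>

lemma two_le_card_verts:
  assumes "p \<in> feasible_paths" "p \<noteq> []"
  shows "2 \<le> card (verts G)"
proof -
  obtain s t where "apath s p t" using assms(1) by (elim feasible_pathE)
  then have "distinct (awalk_verts s p)" "set (awalk_verts s p) \<subseteq> verts G"
    by (auto simp: apath_def awalk_verts_in_verts awalk_def)
  then have "length (awalk_verts s p) \<le> card (verts G)"
    by (metis card_mono distinct_card finite_verts)
  then show ?thesis using assms(2) by (cases p) (auto simp: length_awalk_verts)
qed

text \<open>Settles the case in which \<open>OPT\<close> is 0, so that the required budget bound is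
  0 and Markov's inequality has no positive threshold: all values are integral and LR is
  deterministic.\<close>

lemma LR_of_LP_value_0:
  assumes y: "LP_feasible \<beta> \<alpha> y" and "(\<Sum>e\<in>arcs G. y e) = 0"
  shows "LR G \<eta> y = return_pmf (\<lambda>_. 0)" "solution (\<lambda>_. 0)"
proof -
  have y0: "y e = 0" if "e \<in> arcs G" for e
    using assms that LP_feasible_ge_0[OF y] by (simp add: sum_nonneg_eq_0_iff)
  then have "LR G \<eta> y = Pi_pmf (arcs G) 0 (\<lambda>e. return_pmf 0)"
    unfolding LR_def by (intro Pi_pmf_cong) (auto simp: LR_edge_def)
  then show "LR G \<eta> y = return_pmf (\<lambda>_. 0)" by simp
  have "(\<Sum>e\<in>set p. real (\<beta> e) * y e) = 0" if "p \<in> feasible_paths" for p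
    using feasible_path_arcs(1)[OF that] y0 by (intro sum.neutral) auto
  then show "solution (\<lambda>_. 0)"
    using LP_feasible_path[OF y] by (fastforce simp: solution_def blocks_iff)
qed

text \<open>Used in contrapositive form: a nonzero LP value yields a feasible path, hence an arc,
  \<open>h \<ge> 1\<close> and at least two vertices.\<close>

lemma LP_value_0:
  assumes "LP_optimal \<beta> \<alpha> y" "feasible_paths = {}"
  shows "(\<Sum>e\<in>arcs G. y e) = 0"
proof -
  have "LP_feasible \<beta> \<alpha> (\<lambda>_. 0)" using assms(2) by (simp add: LP_feasible_def)
  then have "(\<Sum>e\<in>arcs G. y e) \<le> 0" 
    using assms(1) by (force simp: LP_optimal_def is_arg_min_linorder)
  moreover have "0 \<le> (\<Sum>e\<in>arcs G. y e)"
    using assms(1) by (intro sum_nonneg) (auto simp: LP_optimal_def is_arg_min_def LP_feasible_def)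
  ultimately show ?thesis by simp
qed

text \<open>In \<open>C\<close> the first factor is that of \<eta>, the second bounds
  \<open>L\<close> relative to h ln n, and the denominator is the failure probability granted to the
  budget. The summand 1 keeps \<open>C\<close> positive even for \<open>B = 0\<close>.\<close>

lemma LR_approximation:
  assumes \<delta>: "0 < \<delta>" "\<delta> < 1" and B: "B = Max (\<beta> ` arcs G)" and opt: "LP_optimal \<beta> \<alpha> y"
  defines "C \<equiv> real B / (1 - exp (- real B)) * (1 + (ln (1 / \<delta>) + 1) / ln 2) / (\<delta> * (1 - exp (- 1))) + 1"
  shows "1 - \<delta> \<le> measure_pmf.prob (LR G (LR_eta B (card (verts G)) h \<delta>) y)
    {x. solution x \<and> real (budget x) \<le> C * (of_int h * ln (real (card (verts G)))) * real OPT}"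
proof (cases "(\<Sum>e\<in>arcs G. y e) = 0")
  case True
  have y: "LP_feasible \<beta> \<alpha> y" using opt by (simp add: LP_optimal_def is_arg_min_def)
  have "budget (\<lambda>_. 0) = 0" by (simp add: budget_def)
  moreover from this have "OPT = 0"
    using cINF_lower[of budget "Collect solution" "\<lambda>_. 0"] LR_of_LP_value_0(2)[OF y True]
    by (simp add: OPT_def)
  ultimately show ?thesis
    using LR_of_LP_value_0[OF y True] \<delta> by simp
next
  case False
  define n where "n = real (card (verts G))"
  define L where "L = ln (n powi h / \<delta>) + 1"
  define K where "K = real B / (1 - exp (- real B))"
  define \<eta> where "\<eta> = LR_eta B (card (verts G)) h \<delta>"
  define H where "H = of_int h * ln n"
  define \<gamma> where "\<gamma> = \<delta> * (1 - exp (-1))"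
  let ?M = "LR G \<eta> y"
  have y: "LP_feasible \<beta> \<alpha> y" using opt by (simp add: LP_optimal_def is_arg_min_def)
  obtain p where p: "p \<in> feasible_paths" using False LP_value_0[OF opt] by auto
  then have "p \<noteq> []" using Nil_not_feasible[OF y] by auto
  then obtain a where "a \<in> arcs G" using feasible_path_arcs[OF p] by (cases p) auto
  have le_B: "\<beta> e \<le> B" if "e \<in> arcs G" for e
    using that by (simp add: B)
  have "0 < B" using weights_pos(1) le_B \<open>a \<in> arcs G\<close> by (meson less_le_trans)
  have n: "2 \<le> n" using two_le_card_verts[OF p \<open>p \<noteq> []\<close>] by (simp add: n_def)
  have "int (length p) < h"
    using weights_pos by (intro length_feasible_path p \<open>p \<noteq> []\<close>) (simp add: linear_f)
  then have "1 \<le> h" by linarith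
  \<comment> \<open>A positive lower bound on h ln n, from \<open>h \<ge> 1\<close> and
    \<open>n \<ge> 2\<close>, later absorbs the additive constants of \<open>L\<close> into a
    multiple of \<open>H\<close>.\<close>
  have H: "ln 2 \<le> H"
    unfolding H_def using n \<open>1 \<le> h\<close> mult_mono[of 1 "real_of_int h" "ln 2" "ln n"] by simp
  have L: "L = H + ln (1 / \<delta>) + 1"
    unfolding L_def H_def using n \<delta> \<open>1 \<le> h\<close> by (simp add: ln_div power_int_def ln_realpow)
  have ln_\<delta>: "0 \<le> ln (1 / \<delta>)" using \<delta> by (intro ln_ge_zero) (simp add: le_divide_eq)
  have "1 \<le> L" using H ln_\<delta> ln_gt_zero[of 2] unfolding L by linarith
  have K: "1 \<le> K" using \<open>0 < B\<close> exp_ge_add_one_self[of "- real B"] by (simp add: K_def field_simps)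
  have \<eta>: "\<eta> = K * L" by (simp add: \<eta>_def LR_eta_def K_def L_def n_def)
  have "1 \<le> \<eta>" using mult_mono[of 1 K 1 L] K \<open>1 \<le> L\<close> unfolding \<eta> by simp
  have "0 < \<gamma>" using \<delta> by (simp add: \<gamma>_def)
  have opt_pos: "0 < real OPT"
  proof -
    have "0 \<le> (\<Sum>e\<in>arcs G. y e)" using LP_feasible_ge_0[OF y] by (rule sum_nonneg)
    then show ?thesis using False LP_value_le_OPT[OF opt] by linarith
  qed
  have fail: "measure_pmf.prob ?M {x. \<not> solution x} \<le> \<delta> * exp (- 1)"
  proof -
    have "measure_pmf.prob ?M {x. \<not> solution x} \<le> n ^ nat h * exp (- L)"
      unfolding n_def using le_B \<open>1 \<le> L\<close> \<eta> by (intro prob_not_solution_LR y) (auto simp: K_def)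
    also have "exp (- L) = \<delta> / n ^ nat h * exp (- 1)"
      unfolding L_def minus_add_distrib exp_add using n \<delta> \<open>1 \<le> h\<close>
      by (simp add: exp_minus power_int_def)
    finally show ?thesis using n by simp
  qed
  \<comment> \<open>The threshold at which Markov's inequality yields exactly \<gamma>, the part of
    \<delta> left over by \<open>fail\<close>.\<close>
  define c where "c = \<eta> * real OPT / \<gamma>"
  have "0 < c" using \<open>1 \<le> \<eta>\<close> opt_pos \<open>0 < \<gamma>\<close> by (simp add: c_def)
  have "finite (set_pmf ?M)" unfolding LR_def by (rule finite_set_Pi_LR_edge) simp
  then have "measure_pmf.prob ?M {x. c \<le> real (budget x)}
      \<le> measure_pmf.expectation ?M (\<lambda>x. real (budget x)) / c"
    using integral_Markov_inequality_measure[of ?M "\<lambda>x. real (budget x)" "{}" c] \<open>0 < c\<close>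
    by (simp add: integrable_measure_pmf_finite)
  also have "\<dots> \<le> \<eta> * real OPT / c"
  proof (rule divide_right_mono)
    have "\<eta> * (\<Sum>e\<in>arcs G. y e) \<le> \<eta> * real OPT"
      using LP_value_le_OPT[OF opt] \<open>1 \<le> \<eta>\<close> by simp
    then show "measure_pmf.expectation ?M (\<lambda>x. real (budget x)) \<le> \<eta> * real OPT"
      using expectation_budget_LR[OF y \<open>1 \<le> \<eta>\<close>] by linarith
  qed (use \<open>0 < c\<close> in simp)
  also have "\<dots> = \<gamma>" using \<open>1 \<le> \<eta>\<close> opt_pos \<open>0 < \<gamma>\<close> by (simp add: c_def)
  finally have costly: "measure_pmf.prob ?M {x. c \<le> real (budget x)} \<le> \<gamma>" .
  have "c \<le> C * H * real OPT"
  proof -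
    \<comment> \<open>The additive constant is nonnegative and \<open>H / ln 2 \<ge> 1\<close>, so
      it may be multiplied by this ratio.\<close>
    have "ln (1 / \<delta>) + 1 \<le> H / ln 2 * (ln (1 / \<delta>) + 1)"
      using H ln_\<delta> mult_right_mono[of 1 "H / ln 2" "ln (1 / \<delta>) + 1"] by (simp add: le_divide_eq)
    then have "L \<le> H * (1 + (ln (1 / \<delta>) + 1) / ln 2)" unfolding L by (simp add: field_simps)
    then have "\<eta> / \<gamma> \<le> K * (H * (1 + (ln (1 / \<delta>) + 1) / ln 2)) / \<gamma>"
      unfolding \<eta> using K \<open>0 < \<gamma>\<close> by (intro divide_right_mono mult_left_mono) auto
    also have "\<dots> \<le> C * H"
    proof -
      have "C = K * (1 + (ln (1 / \<delta>) + 1) / ln 2) / \<gamma> + 1"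
        by (simp only: C_def K_def \<gamma>_def)
      moreover have "0 < H" using H ln_gt_zero[of 2] by linarith
      ultimately show ?thesis by (simp add: algebra_simps add_divide_distrib)
    qed
    finally have "\<eta> / \<gamma> * real OPT \<le> C * H * real OPT" by (rule mult_right_mono) simp
    then show ?thesis by (simp add: c_def)
  qed
  let ?good = "{x. solution x \<and> real (budget x) \<le> C * H * real OPT}"
  have "- ?good \<subseteq> {x. \<not> solution x} \<union> {x. c \<le> real (budget x)}"
    using \<open>c \<le> C * H * real OPT\<close> by auto
  then have "measure_pmf.prob ?M (- ?good) \<le> measure_pmf.prob ?M ({x. \<not> solution x} \<union> {x. c \<le> real (budget x)})"
    by (intro measure_pmf.finite_measure_mono) auto
  also have "\<dots> \<le> measure_pmf.prob ?M {x. \<not> solution x} + measure_pmf.prob ?M {x. c \<le> real (budget x)}"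
    by (intro measure_Un_le) auto
  also have "\<dots> \<le> \<delta>" using fail costly by (simp add: \<gamma>_def algebra_simps)
  finally show ?thesis
    using measure_pmf.prob_compl[of ?good ?M] by (simp add: Compl_eq_Diff_UNIV H_def n_def \<eta>_def)
qed

end

theorem theorem6p1:
  fixes \<beta>max :: nat and \<delta> :: real
  assumes "0 < \<delta>" and "\<delta> < 1"
  shows "\<exists>C>0. \<forall>(G :: ('v, 'e) pre_digraph) f b S T (\<beta> :: 'e \<Rightarrow> nat) (\<alpha> :: 'e \<Rightarrow> nat) x'.
    qosd G S \<longrightarrow>
    (\<forall>e\<in>arcs G. \<beta> e > 0 \<and> \<alpha> e > 0 \<and> (\<forall>k. f e k = real (\<beta> e * k + \<alpha> e))) \<longrightarrow>
    \<beta>max = Max (\<beta> ` arcs G) \<longrightarrow>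
    qosd.LP_optimal G f b S T \<beta> \<alpha> x' \<longrightarrow>
    measure_pmf.prob
      (LR G (LR_eta \<beta>max (card (verts G)) (qosd.h G f T) \<delta>) x')
      {x. qosd.solution G f b S T x \<and>
          real (qosd.budget G x) \<le>
            C * (of_int (qosd.h G f T) * ln (real (card (verts G)))) * real (qosd.OPT G f b S T)}
      \<ge> 1 - \<delta>"
proof -
  \<comment> \<open>\<open>C\<close> depends on \<open>\<beta>max\<close> and \<delta> only, so it
    is fixed before the instance is chosen.\<close>
  define C where "C = real \<beta>max / (1 - exp (- real \<beta>max)) * (1 + (ln (1 / \<delta>) + 1) / ln 2)
    / (\<delta> * (1 - exp (- 1))) + 1"
  \<comment> \<open>For \<open>\<beta>max = 0\<close> the quotient is 0 / 0, which equals 0;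
    positivity of \<open>C\<close> then comes from its last summand.\<close>
  have "0 \<le> real \<beta>max / (1 - exp (- real \<beta>max))" by simp
  moreover have "0 \<le> 1 + (ln (1 / \<delta>) + 1) / ln 2" using assms by simp
  ultimately have "0 < C" unfolding C_def using assms
    by (intro add_nonneg_pos divide_nonneg_nonneg mult_nonneg_nonneg) auto
  then show ?thesis
  proof (intro exI[of _ C] conjI allI impI)
    fix G :: "('v, 'e) pre_digraph" and f b S T and \<beta> \<alpha> :: "'e \<Rightarrow> nat" and x'
    assume "qosd G S"
      and "\<forall>e\<in>arcs G. \<beta> e > 0 \<and> \<alpha> e > 0 \<and> (\<forall>k. f e k = real (\<beta> e * k + \<alpha> e))"
      and "\<beta>max = Max (\<beta> ` arcs G)" and "qosd.LP_optimal G f b S T \<beta> \<alpha> x'"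
    then interpret linear_qosd G f b S T \<beta> \<alpha>
      by (intro linear_qosd.intro linear_qosd_axioms.intro) auto
    show "1 - \<delta> \<le> measure_pmf.prob (LR G (LR_eta \<beta>max (card (verts G)) h \<delta>) x')
      {x. solution x \<and> real (budget x) \<le> C * (of_int h * ln (real (card (verts G)))) * real OPT}"
      unfolding C_def by (rule LR_approximation) fact+
  qed
qed

end
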